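(* Let $\widehat{X}_1,\dots,\widehat{X}_k,\widehat{X}_{k+1},\dots,\widehat{X}_m,\widetilde{X}_{m+1},\dots,\widetilde{X}_n$ be the approximating vector fields on $\mathbb{R}^n$ at $p=0$ of the almost-Riemannian structure defined near $0$ by $X_1,\dots,X_n$ (in privileged coordinates, as described in the context). Then the Lie algebra $\mathcal{L}$ of vector fields on $\mathbb{R}^n$ generated by $$\widehat{X}_1,\dots,\widehat{X}_k,\widehat{X}_{k+1},\dots,\widehat{X}_m,\widetilde{X}_{m+1},\dots,\widetilde{X}_n$$ is finite dimensional.
   Context: Almost-Riemannian structure (ARS): a set of $n$ smooth vector fields $X_1,\dots,X_n$ on a neighborhood $V$ of $p=0$ in $\mathbb{R}^n$, considered as an orthonormal frame, such that (1) they satisfy the rank condition on $V$ (the Lie algebra they generate evaluates to all of $\mathbb{R}^n$ at every point); (2) the singular set $\mathcal{Z}$ of points where $X_1(x),\dots,X_n(x)$ are linearly dependent is nonempty with empty interior. We assume $0\in\mathcal{Z}$. Weights and privileged coordinates: let $\Delta^1=\mathrm{Span}\{X_1,\dots,X_n\}$, $\Delta^{s+1}=\Delta^s+[\Delta^1,\Delta^s]$, $n_s=\dim\Delta^s(0)$, $n_0=0$, and let $r$ be the smallest integer with $n_r=n$. The weights $w_1\le\dots\le w_n$ are defined by $w_i=s$ if $n_{s-1}<i\le n_s$. The nonholonomic order at $0$ of a smooth function $f$ is the largest $s$ such that $(X_{i_1}\cdots X_{i_q}f)(0)=0$ for all $q<s$ and all indices. The canonical coordinates $(x_1,\dots,x_n)$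 of $\mathbb{R}^n$ are assumed privileged at $0$: $x_i$ has nonholonomic order $w_i$ for every $i$. The monomial vector field $x_1^{\alpha_1}\cdots x_n^{\alpha_n}\frac{\partial}{\partial x_j}$ is homogeneous of order $\sum_i\alpha_iw_i-w_j$. In privileged coordinates the Taylor expansion of each $X_i$ at $0$ decomposes as $X_i\sim X_i^{(-1)}+X_i^{(0)}+X_i^{(1)}+\cdots$ with $X_i^{(s)}$ polynomial and homogeneous of order $s$. The nilpotent approximation of $X_i$ is $\widehat{X}_i=X_i^{(-1)}$, and $\widetilde{X}_i=X_i^{(0)}$ denotes its homogeneous component of order $0$. Approximating vector fields: after reordering and after possibly adding to some of the $X_i$ constant-coefficient linear combinations of the previous ones, it is assumed that, for some $k\le m\le n$: $\widehat{X}_1(0),\dots,\widehat{X}_k(0)$ are linearly independent, where $k$ is the rank at $0$ of the nilpotent approximations; $\widehat{X}_{k+1},\dots,\widehat{X}_m$ vanish at $0$, and $\widehat{X}_1,\dots,\widehat{X}_m$ are linearly independent as vector fields; $\widehat{X}_i=0$ for $i=m+1,\dots,n$, and these are replaced by $\widetilde{X}_i$. It is assumed that the $n$ vector fields $\widehat{X}_1,\dots,\widehat{X}_m,\widetilde{X}_{m+1},\dots,\widetilde{X}_n$ are linearly independent as vector fields. *)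

theory Defs
  imports "HOL-Analysis.Analysis" "HOL-Library.Function_Algebras"
begin

text \<open>
  The index type \<open>'n :: {finite,linorder}\<close> plays the role of \<open>{1,\<dots>,n}\<close> with \<open>n = CARD('n)\<close>:
  \<open>pos i\<close> is the rank of \<open>i\<close> in the linear order, a number between \<open>1\<close> and \<open>n\<close>.
  Vector fields defined near \<open>0\<close> are total functions whose values outside of the neighbourhood
  are irrelevant: all notions below are evaluated at points of an open set and are local.
\<close>

type_synonym 'n vfield = "real ^ 'n \<Rightarrow> real ^ 'n"

definition pos :: "'n::{finite,linorder} \<Rightarrow> nat" where
  "pos i = card {j. j \<le> i}"


subsection \<open>The real vector space of vector fields\<close>

definition scale_vf :: "real \<Rightarrow> 'n::finite vfield \<Rightarrow> 'n vfield" where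
  "scale_vf c X = (\<lambda>x. c *\<^sub>R X x)"

global_interpretation vf: vector_space "scale_vf :: real \<Rightarrow> 'n::finite vfield \<Rightarrow> 'n vfield"
  by standard (simp_all add: scale_vf_def fun_eq_iff algebra_simps)

definition vf_indep_family :: "('i \<Rightarrow> 'n::finite vfield) \<Rightarrow> 'i set \<Rightarrow> bool" where
  "vf_indep_family X I \<longleftrightarrow> inj_on X I \<and> vf.independent (X ` I)"

definition indep_family :: "('i \<Rightarrow> 'a::real_vector) \<Rightarrow> 'i set \<Rightarrow> bool" where
  "indep_family v I \<longleftrightarrow> inj_on v I \<and> independent (v ` I)"

definition vf_finite_dimensional :: "'n::finite vfield set \<Rightarrow> bool" where
  "vf_finite_dimensional L \<longleftrightarrow> (\<exists>B. finite B \<and> vf.independent B \<and> vf.span B = L)"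


subsection \<open>Derivatives, smoothness, Lie brackets\<close>

definition partial_deriv ::
    "'n \<Rightarrow> (real ^ 'n \<Rightarrow> 'b::real_normed_vector) \<Rightarrow> real ^ 'n::finite \<Rightarrow> 'b" where
  "partial_deriv i f x = frechet_derivative f (at x) (axis i 1)"

primrec Ck_on :: "nat \<Rightarrow> (real ^ 'n::finite) set \<Rightarrow> (real ^ 'n \<Rightarrow> 'b::real_normed_vector) \<Rightarrow> bool"
  where
    "Ck_on 0 V f \<longleftrightarrow> continuous_on V f"
  | "Ck_on (Suc k) V f \<longleftrightarrow> (\<forall>x\<in>V. f differentiable (at x)) \<and> (\<forall>i. Ck_on k V (partial_deriv i f))"

definition smooth_on :: "(real ^ 'n::finite) set \<Rightarrow> (real ^ 'n \<Rightarrow> 'b::real_normed_vector) \<Rightarrow> bool"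
  where "smooth_on V f \<longleftrightarrow> (\<forall>k. Ck_on k V f)"

text \<open>\<open>X f\<close>: the derivation defined by the vector field \<open>X\<close>, applied to the function \<open>f\<close>.\<close>

definition vf_apply :: "'n::finite vfield \<Rightarrow> (real ^ 'n \<Rightarrow> real) \<Rightarrow> real ^ 'n \<Rightarrow> real" where
  "vf_apply X f x = frechet_derivative f (at x) (X x)"

text \<open>The sign is such that \<open>[X,Y] f = X (Y f) - Y (X f)\<close>.\<close>

definition lie_bracket :: "'n::finite vfield \<Rightarrow> 'n vfield \<Rightarrow> 'n vfield" where
  "lie_bracket X Y x = frechet_derivative Y (at x) (X x) - frechet_derivative X (at x) (Y x)"

definition lie_subalgebra :: "'n::finite vfield set \<Rightarrow> bool" where
  "lie_subalgebra L \<longleftrightarrow> vf.subspace L \<and> (\<forall>X\<in>L. \<forall>Y\<in>L. lie_bracket X Y \<in> L)"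

definition lie_algebra_generated :: "'n::finite vfield set \<Rightarrow> 'n vfield set" where
  "lie_algebra_generated S = lie_subalgebra hull S"


subsection \<open>Almost-Riemannian structures\<close>

definition singular_set :: "(real ^ 'n) set \<Rightarrow> ('n::finite \<Rightarrow> 'n vfield) \<Rightarrow> (real ^ 'n) set" where
  "singular_set V X = {x \<in> V. \<not> indep_family (\<lambda>i. X i x) UNIV}"

definition almost_riemannian :: "(real ^ 'n) set \<Rightarrow> ('n::finite \<Rightarrow> 'n vfield) \<Rightarrow> bool" where
  "almost_riemannian V X \<longleftrightarrow>
     open V \<and> 0 \<in> V \<and>
     (\<forall>i. smooth_on V (X i)) \<and>
     (\<forall>x\<in>V. (\<lambda>Y. Y x) ` lie_algebra_generated (range X) = UNIV) \<and>
     singular_set V X \<noteq> {} \<and> interior (singular_set V X) = {}"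


subsection \<open>Weights and privileged coordinates\<close>

text \<open>\<open>flag X s\<close> is the space \<open>\<Delta>\<^sup>s\<close>, and \<open>growth X s\<close> is the dimension \<open>n\<^sub>s\<close> of \<open>\<Delta>\<^sup>s(0)\<close>.\<close>

fun flag :: "('n::finite \<Rightarrow> 'n vfield) \<Rightarrow> nat \<Rightarrow> 'n vfield set" where
  "flag X 0 = {0}"
| "flag X (Suc 0) = vf.span (range X)"
| "flag X (Suc (Suc s)) =
     vf.span (flag X (Suc s) \<union>
       {lie_bracket Y Z |Y Z. Y \<in> flag X (Suc 0) \<and> Z \<in> flag X (Suc s)})"

definition growth :: "('n::finite \<Rightarrow> 'n vfield) \<Rightarrow> nat \<Rightarrow> nat" where
  "growth X s = dim ((\<lambda>Y. Y 0) ` flag X s)"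

definition weight :: "('n \<Rightarrow> 'n vfield) \<Rightarrow> 'n::{finite,linorder} \<Rightarrow> nat" where
  "weight X i = (THE s. 1 \<le> s \<and> growth X (s - 1) < pos i \<and> pos i \<le> growth X s)"

text \<open>
  All derivatives \<open>(X\<^bsub>i1\<^esub> \<cdots> X\<^bsub>iq\<^esub> f)(0)\<close> with \<open>q < s\<close> vanish; \<open>q = 0\<close> is \<open>f(0) = 0\<close>.
\<close>

definition nonhol_vanishes ::
    "('n \<Rightarrow> 'n vfield) \<Rightarrow> (real ^ 'n::finite \<Rightarrow> real) \<Rightarrow> nat \<Rightarrow> bool" where
  "nonhol_vanishes X f s \<longleftrightarrow>
     (\<forall>is. length is < s \<longrightarrow> foldr (\<lambda>i g. vf_apply (X i) g) is f 0 = 0)"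

definition has_nonhol_order ::
    "('n \<Rightarrow> 'n vfield) \<Rightarrow> (real ^ 'n::finite \<Rightarrow> real) \<Rightarrow> nat \<Rightarrow> bool" where
  "has_nonhol_order X f s \<longleftrightarrow>
     nonhol_vanishes X f s \<and> (\<forall>t. nonhol_vanishes X f t \<longrightarrow> t \<le> s)"

definition privileged_coordinates :: "('n::{finite,linorder} \<Rightarrow> 'n vfield) \<Rightarrow> bool" where
  "privileged_coordinates X \<longleftrightarrow> (\<forall>i. has_nonhol_order X (\<lambda>x. x $ i) (weight X i))"


subsection \<open>Homogeneous components of the Taylor expansion\<close>

definition iterated_partial ::
    "('n \<Rightarrow> nat) \<Rightarrow> (real ^ 'n::{finite,linorder} \<Rightarrow> real) \<Rightarrow> real ^ 'n::{finite,linorder} \<Rightarrow> real" where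
  "iterated_partial \<alpha> f = foldr (\<lambda>i g. (partial_deriv i ^^ \<alpha> i) g) (sorted_list_of_set UNIV) f"

definition taylor_coeff :: "('n \<Rightarrow> nat) \<Rightarrow> (real ^ 'n::{finite,linorder} \<Rightarrow> real) \<Rightarrow> real" where
  "taylor_coeff \<alpha> f = iterated_partial \<alpha> f 0 / (\<Prod>i\<in>UNIV. fact (\<alpha> i))"

text \<open>
  The component of order \<open>s\<close> of the Taylor expansion of \<open>X\<close> at \<open>0\<close>, where the monomial field
  \<open>x\<^sup>\<alpha> \<partial>\<^sub>j\<close> has order \<open>(\<Sum>i. \<alpha> i * w i) - w j\<close>. The sum over \<open>\<alpha>\<close> is finite since weights are positive.
\<close>

definition homogeneous_component ::
    "('n \<Rightarrow> nat) \<Rightarrow> int \<Rightarrow> 'n vfield \<Rightarrow> 'n::{finite,linorder} vfield" where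
  "homogeneous_component w s X x =
     (\<chi> j. \<Sum>\<alpha> | int (\<Sum>i\<in>UNIV. \<alpha> i * w i) - int (w j) = s.
        taylor_coeff \<alpha> (\<lambda>y. X y $ j) * (\<Prod>i\<in>UNIV. (x $ i) ^ \<alpha> i))"


subsection \<open>Approximating vector fields\<close>

definition modified_frame ::
    "('n \<Rightarrow> 'n) \<Rightarrow> ('n \<Rightarrow> 'n \<Rightarrow> real) \<Rightarrow> ('n \<Rightarrow> 'n vfield) \<Rightarrow> 'n::{finite,linorder} \<Rightarrow> 'n vfield" where
  "modified_frame \<sigma> c X i x = X (\<sigma> i) x + (\<Sum>j | j < i. c i j *\<^sub>R X (\<sigma> j) x)"

definition approximating_fields ::
    "('n \<Rightarrow> nat) \<Rightarrow> nat \<Rightarrow> ('n \<Rightarrow> 'n vfield) \<Rightarrow> 'n::{finite,linorder} \<Rightarrow> 'n vfield" where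
  "approximating_fields w m X i =
     (if pos i \<le> m then homogeneous_component w (-1) (X i) else homogeneous_component w 0 (X i))"

text \<open>
  \<open>Xhat i\<close> is the nilpotent approximation of \<open>X i\<close>. Linear independence of vector fields is over
  the constants \<open>\<real>\<close>, not pointwise and not over functions.
\<close>

definition normalized_frame ::
    "('n \<Rightarrow> nat) \<Rightarrow> nat \<Rightarrow> nat \<Rightarrow> ('n::{finite,linorder} \<Rightarrow> 'n vfield) \<Rightarrow> bool" where
  "normalized_frame w k m X \<longleftrightarrow>
     (let Xhat = (\<lambda>i. homogeneous_component w (-1) (X i)) in
        k \<le> m \<and> m \<le> CARD('n) \<and>
        k = dim (range (\<lambda>i. Xhat i 0)) \<and>
        indep_family (\<lambda>i. Xhat i 0) {i. pos i \<le> k} \<and>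
        (\<forall>i. k < pos i \<and> pos i \<le> m \<longrightarrow> Xhat i 0 = 0) \<and>
        vf_indep_family Xhat {i. pos i \<le> m} \<and>
        (\<forall>i. m < pos i \<longrightarrow> Xhat i = 0) \<and>
        vf_indep_family (approximating_fields w m X) UNIV)"

end

theory Submission
  imports Defs
begin

text \<open>
  The generators are homogeneous of order \<open>-1\<close> or \<open>0\<close>, and brackets add orders, so nothing of
  positive order can ever be produced. The order of \<open>x\<^sup>\<alpha> \<partial>\<^sub>j\<close> is \<open>(\<Sum>i. \<alpha> i * w i) - w j\<close>; as all
  weights are positive, order \<open>\<le> 0\<close> bounds every exponent, and only finitely many monomial fields
  satisfy it. Their span is therefore a finite-dimensional Lie algebra
  (\<open>lie_subalgebra_span_nonpos_fields\<close>, \<open>finite_nonpos_fields\<close>) containing the generators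
  (\<open>homogeneous_component_in_span\<close>), and the Lie algebra they generate is a subspace of it.

  Positivity of the weights is read off from the privileged coordinates: each coordinate function
  vanishes at \<open>0\<close>, so its nonholonomic order is at least \<open>1\<close> (\<open>weight_pos\<close>).
\<close>

section \<open>Lie algebras spanned by a set of vector fields\<close>

lemma differentiable_on_vf_span:
  assumes "\<And>X x. X \<in> S \<Longrightarrow> X differentiable (at x)" and "Y \<in> vf.span S"
  shows "Y differentiable (at x)"
  using assms(2)
proof (induction rule: vf.span_induct_alt)
  case base
  then show ?case by (simp add: zero_fun_def)
next
  case (step c X Y)
  then show ?case
    using assms(1)[of X x] by (auto simp: scale_vf_def plus_fun_def)
qed

lemma lie_bracket_zero_left:
  assumes "\<And>x. Y differentiable (at x)"
  shows "lie_bracket 0 Y = 0"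
  using linear_0[OF linear_frechet_derivative[OF assms]]
  by (simp add: lie_bracket_def fun_eq_iff zero_fun_def)

lemma lie_bracket_linear_left:
  assumes X: "\<And>x. X differentiable (at x)" and X': "\<And>x. X' differentiable (at x)"
    and Y: "\<And>x. Y differentiable (at x)"
  shows "lie_bracket (scale_vf c X + X') Y = scale_vf c (lie_bracket X Y) + lie_bracket X' Y"
proof
  fix x
  have lin: "linear (frechet_derivative Y (at x))"
    using Y by (rule linear_frechet_derivative)
  have "((\<lambda>x. c *\<^sub>R X x + X' x) has_derivative
      (\<lambda>h. c *\<^sub>R frechet_derivative X (at x) h + frechet_derivative X' (at x) h)) (at x)"
    by (intro has_derivative_add has_derivative_scaleR_right)
       (use X X' frechet_derivative_works in blast)+
  then have "frechet_derivative (\<lambda>x. c *\<^sub>R X x + X' x) (at x)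
      = (\<lambda>h. c *\<^sub>R frechet_derivative X (at x) h + frechet_derivative X' (at x) h)"
    by (rule frechet_derivative_at[symmetric])
  then show "lie_bracket (scale_vf c X + X') Y x
      = (scale_vf c (lie_bracket X Y) + lie_bracket X' Y) x"
    by (simp add: lie_bracket_def scale_vf_def plus_fun_def linear_add[OF lin] linear_scale[OF lin]
        scaleR_diff_right)
qed

lemma lie_bracket_antisym: "lie_bracket X Y = scale_vf (-1) (lie_bracket Y X)"
  by (simp add: lie_bracket_def scale_vf_def fun_eq_iff)

text \<open>
  Bilinearity carries the bracket condition from \<open>S\<close> to its span, one argument at a time. The
  bracket is bilinear only on differentiable fields, because
  \<open>frechet_derivative\<close> is an unspecified value elsewhere.
\<close>
lemma lie_subalgebra_vf_span:
  assumes diff: "\<And>X x. X \<in> S \<Longrightarrow> X differentiable (at x)"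
    and bracket: "\<And>X Y. X \<in> S \<Longrightarrow> Y \<in> S \<Longrightarrow> lie_bracket X Y \<in> vf.span S"
  shows "lie_subalgebra (vf.span S)"
proof -
  have diff_span: "Y differentiable (at x)" if "Y \<in> vf.span S" for Y x
    using differentiable_on_vf_span[OF _ that] diff by blast
  have left: "lie_bracket X Y \<in> vf.span S"
    if "X \<in> vf.span S" and Y: "Y \<in> vf.span S"
      and gen: "\<And>Z. Z \<in> S \<Longrightarrow> lie_bracket Z Y \<in> vf.span S" for X Y
  proof -
    have "X \<in> vf.span S \<and> lie_bracket X Y \<in> vf.span S"
      using that(1)
    proof (induction rule: vf.span_induct_alt)
      case base
      then show ?case
        using lie_bracket_zero_left[OF diff_span[OF Y]] vf.span_zero
        by (metis zero_fun_def)
    next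
      case (step c Z X)
      have "lie_bracket (scale_vf c Z + X) Y = scale_vf c (lie_bracket Z Y) + lie_bracket X Y"
        using step diff diff_span Y by (intro lie_bracket_linear_left) auto
      moreover have "scale_vf c Z + X \<in> vf.span S"
        using step vf.span_base by (intro vf.span_add vf.span_scale) blast+
      moreover have "scale_vf c (lie_bracket Z Y) + lie_bracket X Y \<in> vf.span S"
        using step gen by (intro vf.span_add vf.span_scale) blast+
      ultimately show ?case by metis
    qed
    then show ?thesis ..
  qed
  have half: "lie_bracket Z Y \<in> vf.span S" if "Z \<in> S" "Y \<in> vf.span S" for Z Y
    using that left[of Y Z] bracket lie_bracket_antisym[of Z Y]
    by (metis vf.span_base vf.span_scale)
  show ?thesis
    unfolding lie_subalgebra_def using left half by (auto intro: vf.subspace_span)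
qed

text \<open>
  \<open>vf_finite_dimensional\<close> asks for a basis of the generated algebra itself; a maximal independent
  subset is one, and it is finite because it lies in the span of the finite set \<open>S\<close>.
\<close>
lemma vf_finite_dimensional_lie_algebra_generated:
  assumes "finite S" and "lie_subalgebra (vf.span S)" and "G \<subseteq> vf.span S"
  shows "vf_finite_dimensional (lie_algebra_generated G)"
proof -
  let ?L = "lie_algebra_generated G"
  have sub: "?L \<subseteq> vf.span S"
    unfolding lie_algebra_generated_def using assms(3,2) by (rule hull_minimal)
  have "lie_subalgebra ?L"
    unfolding lie_algebra_generated_def
    by (rule hull_in) (auto simp: lie_subalgebra_def intro: vf.subspace_Inter)
  then have L: "vf.subspace ?L"
    by (simp add: lie_subalgebra_def)
  obtain B where B: "B \<subseteq> ?L" "vf.independent B" "?L \<subseteq> vf.span B"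
    using vf.maximal_independent_subset by blast
  have "finite B"
    using vf.independent_span_bound[OF assms(1) B(2)] B(1) sub by auto
  moreover have "vf.span B = ?L"
    using B L by (intro equalityI vf.span_minimal)
  ultimately show ?thesis
    using B(2) unfolding vf_finite_dimensional_def by blast
qed


section \<open>Monomial vector fields of nonpositive order\<close>

definition monomial :: "('n \<Rightarrow> nat) \<Rightarrow> real ^ 'n::finite \<Rightarrow> real" where
  "monomial \<alpha> x = (\<Prod>i\<in>UNIV. (x $ i) ^ \<alpha> i)"

definition monomial_field :: "('n \<Rightarrow> nat) \<Rightarrow> 'n \<Rightarrow> 'n::finite vfield" where
  "monomial_field \<alpha> j = (\<lambda>x. monomial \<alpha> x *\<^sub>R axis j 1)"

definition weighted_degree :: "('n::finite \<Rightarrow> nat) \<Rightarrow> ('n \<Rightarrow> nat) \<Rightarrow> nat" where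
  "weighted_degree w \<alpha> = (\<Sum>i\<in>UNIV. \<alpha> i * w i)"

definition nonpos_fields :: "('n::finite \<Rightarrow> nat) \<Rightarrow> 'n vfield set" where
  "nonpos_fields w = {monomial_field \<alpha> j |\<alpha> j. weighted_degree w \<alpha> \<le> w j}"

lemma monomial_add: "monomial (\<lambda>i. \<alpha> i + \<beta> i) x = monomial \<alpha> x * monomial \<beta> x"
  by (simp add: monomial_def power_add prod.distrib)

lemma weighted_degree_add:
  "weighted_degree w (\<lambda>i. \<alpha> i + \<beta> i) = weighted_degree w \<alpha> + weighted_degree w \<beta>"
  by (simp add: weighted_degree_def algebra_simps sum.distrib)

lemma weighted_degree_lower:
  assumes "\<beta> i > 0"
  shows "weighted_degree w (\<beta>(i := \<beta> i - 1)) + w i = weighted_degree w \<beta>"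
proof -
  have "weighted_degree w \<beta> = \<beta> i * w i + (\<Sum>l\<in>UNIV - {i}. \<beta> l * w l)"
    by (simp add: weighted_degree_def sum.remove[of UNIV i])
  moreover have "weighted_degree w (\<beta>(i := \<beta> i - 1))
      = (\<beta> i - 1) * w i + (\<Sum>l\<in>UNIV - {i}. \<beta> l * w l)"
    by (simp add: weighted_degree_def sum.remove[of UNIV i])
  ultimately show ?thesis
    using assms by (cases "\<beta> i") auto
qed

lemma has_derivative_monomial:
  "(monomial \<beta> has_derivative
     (\<lambda>h. \<Sum>i\<in>UNIV. (h $ i) * (real (\<beta> i) * monomial (\<beta>(i := \<beta> i - 1)) x))) (at x)"
proof -
  have coord: "((\<lambda>x. (x $ i) ^ \<beta> i) has_derivative
      (\<lambda>h. real (\<beta> i) * (x $ i) ^ (\<beta> i - 1) * h $ i)) (at x)" for i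
    by (auto intro!: derivative_eq_intros simp: fun_eq_iff
        bounded_linear_imp_has_derivative[OF bounded_linear_vec_nth])
  have lower: "monomial (\<beta>(i := \<beta> i - 1)) x
      = (x $ i) ^ (\<beta> i - 1) * (\<Prod>l\<in>UNIV - {i}. (x $ l) ^ \<beta> l)" for i
    by (simp add: monomial_def prod.remove[of UNIV i])
  show ?thesis
    unfolding lower
    using has_derivative_prod[where I = UNIV and f = "\<lambda>i x. (x $ i) ^ \<beta> i", OF coord]
    by (simp add: mult_ac monomial_def[abs_def])
qed

lemma has_derivative_monomial_field:
  "(monomial_field \<beta> j has_derivative
     (\<lambda>h. (\<Sum>i\<in>UNIV. (h $ i) * (real (\<beta> i) * monomial (\<beta>(i := \<beta> i - 1)) x)) *\<^sub>R axis j 1)) (at x)"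
  unfolding monomial_field_def by (intro has_derivative_scaleR_left has_derivative_monomial)

lemma frechet_derivative_monomial_field:
  "frechet_derivative (monomial_field \<beta> j) (at x) (monomial_field \<alpha> i x)
     = real (\<beta> i) *\<^sub>R monomial_field (\<lambda>l. \<alpha> l + (\<beta>(i := \<beta> i - 1)) l) j x"
proof -
  have "(\<Sum>l\<in>UNIV. (monomial_field \<alpha> i x $ l) * (real (\<beta> l) * monomial (\<beta>(l := \<beta> l - 1)) x))
      = (\<Sum>l\<in>UNIV. if l = i
           then monomial \<alpha> x * (real (\<beta> l) * monomial (\<beta>(l := \<beta> l - 1)) x) else 0)"
    by (intro sum.cong) (auto simp: monomial_field_def axis_def)
  then show ?thesis
    unfolding frechet_derivative_at[OF has_derivative_monomial_field, symmetric]
    by (simp only: monomial_field_def[of _ j] monomial_add) simp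
qed

text \<open>
  Each term with nonzero coefficient has as its order the sum of the orders of the two fields, as
  differentiating in direction \<open>i\<close> lowers the weighted degree by \<open>w i\<close>.
\<close>
lemma lie_bracket_monomial_field:
  "lie_bracket (monomial_field \<alpha> i) (monomial_field \<beta> j)
     = scale_vf (real (\<beta> i)) (monomial_field (\<lambda>l. \<alpha> l + (\<beta>(i := \<beta> i - 1)) l) j)
       - scale_vf (real (\<alpha> j)) (monomial_field (\<lambda>l. \<beta> l + (\<alpha>(j := \<alpha> j - 1)) l) i)"
  by (simp only: lie_bracket_def frechet_derivative_monomial_field scale_vf_def fun_eq_iff
      minus_apply simp_thms)

text \<open>
  When \<open>\<beta> i = 0\<close> the exponent \<open>\<beta> i - 1\<close> is truncated and the degree count fails, but then
  the coefficient vanishes.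
\<close>
lemma nonpos_derivative_term:
  assumes "weighted_degree w \<alpha> \<le> w i" and "weighted_degree w \<beta> \<le> w j"
  shows "scale_vf (real (\<beta> i)) (monomial_field (\<lambda>l. \<alpha> l + (\<beta>(i := \<beta> i - 1)) l) j)
           \<in> vf.span (nonpos_fields w)"
proof (cases "\<beta> i = 0")
  case True
  then show ?thesis by (simp add: vf.span_zero)
next
  case False
  then have "weighted_degree w (\<lambda>l. \<alpha> l + (\<beta>(i := \<beta> i - 1)) l) \<le> w j"
    using assms weighted_degree_lower[of \<beta> i w] by (simp only: weighted_degree_add) linarith
  then show ?thesis
    by (intro vf.span_scale vf.span_base) (auto simp only: nonpos_fields_def)
qed

lemma lie_subalgebra_span_nonpos_fields: "lie_subalgebra (vf.span (nonpos_fields w))"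
proof (rule lie_subalgebra_vf_span)
  show "X differentiable (at x)" if "X \<in> nonpos_fields w" for X x
    using that has_derivative_monomial_field
    by (auto simp: nonpos_fields_def differentiable_def)
next
  fix X Y assume "X \<in> nonpos_fields w" "Y \<in> nonpos_fields w"
  then obtain \<alpha> i \<beta> j where "X = monomial_field \<alpha> i" "weighted_degree w \<alpha> \<le> w i"
      "Y = monomial_field \<beta> j" "weighted_degree w \<beta> \<le> w j"
    by (auto simp: nonpos_fields_def)
  then show "lie_bracket X Y \<in> vf.span (nonpos_fields w)"
    by (simp only: lie_bracket_monomial_field) (intro vf.span_diff nonpos_derivative_term)
qed

lemma finite_weighted_degree_le:
  assumes "\<And>i. w i > 0"
  shows "finite {\<alpha>. weighted_degree w \<alpha> \<le> d}"
proof (rule finite_subset)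
  show "{\<alpha>. weighted_degree w \<alpha> \<le> d} \<subseteq> PiE UNIV (\<lambda>_. {..d})"
  proof safe
    fix \<alpha> i assume le: "weighted_degree w \<alpha> \<le> d"
    have "\<alpha> i \<le> \<alpha> i * w i" using assms[of i] by simp
    also have "\<dots> \<le> weighted_degree w \<alpha>"
      unfolding weighted_degree_def by (rule member_le_sum) auto
    finally show "\<alpha> i \<le> d" using le by simp
  qed auto
qed (simp add: finite_PiE)

lemma finite_nonpos_fields:
  assumes "\<And>i. w i > 0"
  shows "finite (nonpos_fields w)"
proof -
  have "nonpos_fields w \<subseteq> (\<Union>j. (\<lambda>\<alpha>. monomial_field \<alpha> j) ` {\<alpha>. weighted_degree w \<alpha> \<le> w j})"
    by (auto simp: nonpos_fields_def)
  then show ?thesis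
    by (rule finite_subset) (intro finite_UN_I finite_imageI finite_weighted_degree_le assms finite)
qed


section \<open>The approximating vector fields\<close>

lemma sum_vf_apply: "(\<Sum>a\<in>A. F a) x = (\<Sum>a\<in>A. F a x)" for F :: "'a \<Rightarrow> 'n::finite vfield"
  by (induction A rule: infinite_finite_induct) auto

lemma homogeneous_component_in_span:
  assumes "s \<le> 0"
  shows "homogeneous_component w s X \<in> vf.span (nonpos_fields w)"
proof -
  define A where "A j = {\<alpha>. int (\<Sum>i\<in>UNIV. \<alpha> i * w i) - int (w j) = s}" for j
  have "homogeneous_component w s X = (\<Sum>j\<in>UNIV. \<Sum>\<alpha>\<in>A j.
      scale_vf (taylor_coeff \<alpha> (\<lambda>y. X y $ j)) (monomial_field \<alpha> j))" (is "_ = ?R")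
  proof
    fix x
    have "?R x $ l = homogeneous_component w s X x $ l" for l
    proof -
      have "?R x $ l = (\<Sum>j\<in>UNIV. if j = l
          then \<Sum>\<alpha>\<in>A j. taylor_coeff \<alpha> (\<lambda>y. X y $ j) * monomial \<alpha> x else 0)"
        unfolding sum_vf_apply sum_component
        by (intro sum.cong refl) (auto simp: scale_vf_def monomial_field_def axis_def)
      then show ?thesis
        by (simp add: homogeneous_component_def monomial_def A_def)
    qed
    then show "homogeneous_component w s X x = ?R x"
      by (simp add: vec_eq_iff)
  qed
  moreover have "monomial_field \<alpha> j \<in> nonpos_fields w" if "\<alpha> \<in> A j" for \<alpha> j
  proof -
    have "int (weighted_degree w \<alpha>) \<le> int (w j)"
      using that assms unfolding A_def weighted_degree_def by simp
    then show ?thesis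
      unfolding nonpos_fields_def by auto
  qed
  ultimately show ?thesis
    by (auto intro!: vf.span_sum vf.span_scale intro: vf.span_base)
qed

text \<open>The empty word of derivations already gives order at least \<open>1\<close>, as \<open>x\<^sub>i\<close> vanishes at \<open>0\<close>.\<close>
lemma weight_pos:
  assumes "privileged_coordinates X"
  shows "weight X i > 0"
proof -
  have "nonhol_vanishes X (\<lambda>x. x $ i) 1"
    by (simp add: nonhol_vanishes_def)
  then show ?thesis
    using assms by (force simp: privileged_coordinates_def has_nonhol_order_def)
qed

theorem proposition1:
  fixes V :: "(real ^ 'n::{finite,linorder}) set"
    and X :: "'n \<Rightarrow> 'n vfield"
    and \<sigma> :: "'n \<Rightarrow> 'n"
    and c :: "'n \<Rightarrow> 'n \<Rightarrow> real"
    and k m :: nat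
  assumes "almost_riemannian V X"
    and "0 \<in> singular_set V X"
    and "privileged_coordinates X"
    and "bij \<sigma>"
    and "normalized_frame (weight X) k m (modified_frame \<sigma> c X)"
  shows "vf_finite_dimensional
           (lie_algebra_generated
             (range (approximating_fields (weight X) m (modified_frame \<sigma> c X))))"
proof (rule vf_finite_dimensional_lie_algebra_generated)
  show "finite (nonpos_fields (weight X))"
    by (intro finite_nonpos_fields weight_pos assms(3))
  show "lie_subalgebra (vf.span (nonpos_fields (weight X)))"
    by (rule lie_subalgebra_span_nonpos_fields)
  show "range (approximating_fields (weight X) m (modified_frame \<sigma> c X))
      \<subseteq> vf.span (nonpos_fields (weight X))"
    by (auto simp: approximating_fields_def intro!: homogeneous_component_in_span)
qed

end
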